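(* Let $n\ge 1$ be an integer and let $f,g:(0,\infty)\to\mathbb{C}$ be measurable functions. The following Parseval–Goldstein type identities hold, provided that the integrals involved converge absolutely: $$\int_0^\infty y^{2n-1}\,\mathcal{L}_{2n}\{f(x);y\}\,\mathcal{L}_{2n}\{g(u);y\}\,dy=\frac{1}{2n}\int_0^\infty x^{2n-1}f(x)\,\mathcal{P}_{2n}\{g(u);x\}\,dx,$$ $$\int_0^\infty y^{2n-1}\,\mathcal{L}_{2n}\{f(x);y\}\,\mathcal{L}_{2n}\{g(u);y\}\,dy=\frac{1}{2n}\int_0^\infty u^{2n-1}g(u)\,\mathcal{P}_{2n}\{f(x);u\}\,du,$$ and $$\int_0^\infty x^{2n-1}f(x)\,\mathcal{P}_{2n}\{g(u);x\}\,dx=\int_0^\infty u^{2n-1}g(u)\,\mathcal{P}_{2n}\{f(x);u\}\,du.$$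
   Context: For an integer $n\ge 1$, a function $f$ on $(0,\infty)$ and $y>0$, define $$\mathcal{L}_{2n}\{f(x);y\}=\int_0^\infty x^{2n-1}\exp(-y^{2n}x^{2n})f(x)\,dx,\qquad \mathcal{P}_{2n}\{f(x);y\}=\int_0^\infty\frac{x^{2n-1}f(x)}{x^{2n}+y^{2n}}\,dx.$$ In the notation $\mathcal{T}\{f(x);y\}$, the variable $x$ is the dummy variable of the function being transformed and $y$ is the point at which the transform is evaluated. Absolute convergence of the (iterated) integrals means that they remain finite when $f,g$ are replaced by $|f|,|g|$. *)

theory Defs
  imports "HOL-Analysis.Analysis"
begin

text \<open>All integrals are over the half-line with respect to Lebesgue measure; only the values of a
  function on the half-line matter. The Bochner integral of a non-integrable function is 0, so
  absolute convergence has to be expressed separately; this is done below through extended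
  nonnegative counterparts of both transforms.\<close>

definition laplace2n :: "nat \<Rightarrow> (real \<Rightarrow> complex) \<Rightarrow> real \<Rightarrow> complex" where
  "laplace2n n f y =
     (\<integral>x. of_real (x ^ (2 * n - 1) * exp (- (y ^ (2 * n) * x ^ (2 * n)))) * f x
        \<partial>lebesgue_on {0<..})"

definition potential2n :: "nat \<Rightarrow> (real \<Rightarrow> complex) \<Rightarrow> real \<Rightarrow> complex" where
  "potential2n n f y =
     (\<integral>x. of_real (x ^ (2 * n - 1)) * f x / of_real (x ^ (2 * n) + y ^ (2 * n))
        \<partial>lebesgue_on {0<..})"

definition nn_laplace2n :: "nat \<Rightarrow> (real \<Rightarrow> ennreal) \<Rightarrow> real \<Rightarrow> ennreal" where
  "nn_laplace2n n h y =
     (\<integral>\<^sup>+x. ennreal (x ^ (2 * n - 1) * exp (- (y ^ (2 * n) * x ^ (2 * n)))) * h x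
        \<partial>lebesgue_on {0<..})"

definition nn_potential2n :: "nat \<Rightarrow> (real \<Rightarrow> ennreal) \<Rightarrow> real \<Rightarrow> ennreal" where
  "nn_potential2n n h y =
     (\<integral>\<^sup>+x. ennreal (x ^ (2 * n - 1)) * h x / ennreal (x ^ (2 * n) + y ^ (2 * n))
        \<partial>lebesgue_on {0<..})"

text \<open>An iterated integral converges absolutely if it is finite after \<open>f\<close>, \<open>g\<close> are replaced by
  their absolute values. In \<open>ennreal\<close>, \<open>0 * \<infinity> = 0\<close>, so an inner integral may be infinite where its
  cofactor vanishes; requiring the inner integrals to be finite as well would only strengthen
  these conditions.\<close>

definition laplace_product_abs_conv ::
    "nat \<Rightarrow> (real \<Rightarrow> complex) \<Rightarrow> (real \<Rightarrow> complex) \<Rightarrow> bool" where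
  "laplace_product_abs_conv n f g \<longleftrightarrow>
     (\<integral>\<^sup>+y. ennreal (y ^ (2 * n - 1))
            * nn_laplace2n n (\<lambda>x. ennreal (cmod (f x))) y
            * nn_laplace2n n (\<lambda>u. ennreal (cmod (g u))) y
        \<partial>lebesgue_on {0<..}) < \<infinity>"

definition potential_pairing_abs_conv ::
    "nat \<Rightarrow> (real \<Rightarrow> complex) \<Rightarrow> (real \<Rightarrow> complex) \<Rightarrow> bool" where
  "potential_pairing_abs_conv n f g \<longleftrightarrow>
     (\<integral>\<^sup>+x. ennreal (x ^ (2 * n - 1)) * ennreal (cmod (f x))
            * nn_potential2n n (\<lambda>u. ennreal (cmod (g u))) x
        \<partial>lebesgue_on {0<..}) < \<infinity>"

end

theory Submission
  imports Defs
begin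

text \<open>Since the product of the two exponentials is \<open>exp (- (x\<^sup>m + u\<^sup>m) * y\<^sup>m)\<close> with \<open>m = 2 * n\<close>,
  and its integral against \<open>y ^ (m - 1)\<close> is \<open>1 / (m * (x\<^sup>m + u\<^sup>m))\<close>, integrating out \<open>y\<close> in the
  threefold integral produces the kernel of the potential transform. Absolute convergence
  justifies the exchange by Fubini's theorem; the remaining identities come from exchanging
  \<open>f\<close> and \<open>g\<close>.\<close>

text \<open>Needed for every use of Fubini and Tonelli below. A countable cover by Borel sets of
  finite measure still works for the completion, which agrees with \<open>lborel\<close> on Borel
  sets.\<close>

lemma sigma_finite_lebesgue_on:
  assumes "S \<in> sets lebesgue"
  shows "sigma_finite_measure (lebesgue_on S :: 'a::euclidean_space measure)"
proof (rule sigma_finite_measure_restrict_space)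
  show "sigma_finite_measure (lebesgue :: 'a measure)"
  proof
    obtain A :: "'a set set" where A: "countable A" "A \<subseteq> sets lborel" "\<Union>A = space lborel"
        "\<forall>a\<in>A. emeasure lborel a \<noteq> \<infinity>"
      using lborel.sigma_finite_countable by blast
    then show "\<exists>A. countable A \<and> A \<subseteq> sets (lebesgue :: 'a measure)
        \<and> \<Union>A = space lebesgue \<and> (\<forall>a\<in>A. emeasure lebesgue a \<noteq> \<infinity>)"
      by (intro exI[of _ A]) (auto simp: subset_iff)
  qed
qed (use assms in auto)

interpretation halfline: pair_sigma_finite
  "lebesgue_on {0<..} :: real measure" "lebesgue_on {0<..} :: real measure"
  by (intro pair_sigma_finite.intro sigma_finite_lebesgue_on) auto

lemma measurable_halfline_id [measurable]:
  "(\<lambda>x::real. x) \<in> borel_measurable (lebesgue_on {0<..})"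
  by (simp add: borel_measurable_if_D measurable_completion measurable_restrict_space1)

text \<open>The integrand has the antiderivative \<open>?F\<close>, which tends to 0 at infinity.
  The lemma is used with exponent \<open>2 * n\<close> and
  \<open>s = x ^ (2 * n) + u ^ (2 * n)\<close>, where it produces the denominator of the potential
  transform.\<close>

lemma nn_integral_power_exp:
  fixes s :: real
  assumes "n \<ge> 1" "s > 0"
  shows "(\<integral>\<^sup>+y. ennreal (y ^ (n - 1) * exp (- (s * y ^ n))) \<partial>lebesgue_on {0<..})
    = ennreal (1 / (n * s))"
proof -
  let ?f = "\<lambda>y::real. y ^ (n - 1) * exp (- (s * y ^ n))"
  let ?F = "\<lambda>y::real. - exp (- (s * y ^ n)) / (n * s)"
  have "(\<integral>\<^sup>+y. ennreal (?f y) \<partial>lebesgue_on {0<..})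
      = (\<integral>\<^sup>+y. ennreal (?f y) * indicator {0<..} y \<partial>lborel)"
    by (simp add: nn_integral_restrict_space nn_integral_completion)
  \<comment> \<open>The fundamental theorem is applied on the closed half-line; the added point 0 is
    a null set.\<close>
  also have "\<dots> = (\<integral>\<^sup>+y. ennreal (?f y) * indicator {0..} y \<partial>lborel)"
    using AE_lborel_singleton[of "0::real"]
    by (intro nn_integral_cong_AE) (auto elim!: eventually_mono split: split_indicator)
  also have "\<dots> = ennreal (0 - ?F 0)"
  proof (rule nn_integral_FTC_atLeast)
    show "DERIV ?F y :> ?f y" for y
      using assms by (auto intro!: derivative_eq_intros simp: field_simps)
    have "filterlim (\<lambda>y. s * y ^ n) at_top at_top"
      using assms
      by (intro filterlim_tendsto_pos_mult_at_top[OF tendsto_const] filterlim_pow_at_top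
          filterlim_ident) auto
    then have "((\<lambda>y. exp (- (s * y ^ n))) \<longlongrightarrow> 0) at_top"
      by (intro filterlim_compose[OF exp_at_bot] filterlim_compose[OF filterlim_uminus_at_bot_at_top])
    from tendsto_divide[OF tendsto_minus[OF this] tendsto_const, of "n * s"]
    show "(?F \<longlongrightarrow> 0) at_top" using assms by simp
  qed auto
  \<comment> \<open>Since \<open>n\<close> is positive, \<open>0 ^ n = 0\<close>, so
    \<open>?F 0\<close> is \<open>- 1 / (n * s)\<close>.\<close>
  finally show ?thesis using assms by (simp add: power_0_left)
qed

lemma integral_power_exp:
  fixes s :: real
  assumes "n \<ge> 1" "s > 0"
  shows "(\<integral>y. y ^ (n - 1) * exp (- (s * y ^ n)) \<partial>lebesgue_on {0<..}) = 1 / (n * s)"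
proof -
  have "AE y in lebesgue_on {0<..}. 0 \<le> y ^ (n - 1) * exp (- (s * y ^ n))"
    by (intro AE_I2) (simp add: space_restrict_space)
  then have "has_bochner_integral (lebesgue_on {0<..}) (\<lambda>y. y ^ (n - 1) * exp (- (s * y ^ n)))
      (1 / (n * s))"
    using assms by (intro has_bochner_integral_nn_integral nn_integral_power_exp) auto
  then show ?thesis by (rule has_bochner_integral_integral_eq)
qed

text \<open>The joint integrand of the potential pairing. It is unchanged when \<open>f\<close> and
  \<open>x\<close> trade places with \<open>g\<close> and \<open>u\<close>, which is the source of
  the symmetry between the identities.\<close>

definition pairing_kernel ::
    "nat \<Rightarrow> (real \<Rightarrow> complex) \<Rightarrow> (real \<Rightarrow> complex) \<Rightarrow> real \<Rightarrow> real \<Rightarrow> complex" where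
  "pairing_kernel n f g x u =
     of_real (x ^ (2 * n - 1) * u ^ (2 * n - 1) / (x ^ (2 * n) + u ^ (2 * n))) * (f x * g u)"

lemma pairing_kernel_commute: "pairing_kernel n f g x u = pairing_kernel n g f u x"
  by (simp add: pairing_kernel_def ac_simps)

text \<open>The factor depending on \<open>x\<close> moves into the inner integral. This is safe
  even where that integral diverges, since both sides are then 0 by the convention for Bochner
  integrals.\<close>

lemma integral_pairing_kernel:
  "(\<integral>x. of_real (x ^ (2 * n - 1)) * f x * potential2n n g x \<partial>lebesgue_on {0<..})
    = (\<integral>x. \<integral>u. pairing_kernel n f g x u \<partial>lebesgue_on {0<..} \<partial>lebesgue_on {0<..})"
  unfolding potential2n_def integral_mult_right_zero[symmetric] pairing_kernel_def
  by (intro Bochner_Integration.integral_cong refl) (simp add: ac_simps)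

text \<open>By Tonelli, the integral of the norm over the product is the iterated integral that
  \<open>potential_pairing_abs_conv\<close> requires to be finite.\<close>

lemma integrable_pairing_kernel:
  assumes [measurable]: "f \<in> borel_measurable (lebesgue_on {0<..})"
      "g \<in> borel_measurable (lebesgue_on {0<..})"
    and conv: "potential_pairing_abs_conv n f g"
  shows "integrable (lebesgue_on {0<..} \<Otimes>\<^sub>M lebesgue_on {0<..})
    (\<lambda>(x, u). pairing_kernel n f g x u)"
proof (rule integrableI_bounded)
  let ?M = "lebesgue_on {0<..} :: real measure"
  show [measurable]: "(\<lambda>(x, u). pairing_kernel n f g x u) \<in> borel_measurable (?M \<Otimes>\<^sub>M ?M)"
    unfolding pairing_kernel_def by measurable
  have "(\<integral>\<^sup>+z. norm (case z of (x, u) \<Rightarrow> pairing_kernel n f g x u) \<partial>(?M \<Otimes>\<^sub>M ?M))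
      = (\<integral>\<^sup>+x. \<integral>\<^sup>+u. norm (pairing_kernel n f g x u) \<partial>?M \<partial>?M)"
    by (subst halfline.M1.nn_integral_fst[symmetric]) auto
  also have "\<dots> = (\<integral>\<^sup>+x. ennreal (x ^ (2 * n - 1)) * ennreal (cmod (f x))
      * nn_potential2n n (\<lambda>u. ennreal (cmod (g u))) x \<partial>?M)"
  proof (intro nn_integral_cong)
    fix x assume "x \<in> space ?M"
    then have x: "x > 0" by (simp add: space_restrict_space)
    have "(\<integral>\<^sup>+u. norm (pairing_kernel n f g x u) \<partial>?M)
        = (\<integral>\<^sup>+u. (ennreal (x ^ (2 * n - 1)) * ennreal (cmod (f x))) *
            (ennreal (u ^ (2 * n - 1)) * ennreal (cmod (g u))
              / ennreal (u ^ (2 * n) + x ^ (2 * n))) \<partial>?M)"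
    proof (intro nn_integral_cong)
      fix u assume "u \<in> space ?M"
      then have u: "u > 0" by (simp add: space_restrict_space)
      \<comment> \<open>A positive denominator makes division in \<open>ennreal\<close> agree with
        real division.\<close>
      have pos: "u ^ (2 * n) + x ^ (2 * n) > 0" using u x by (simp add: add_pos_pos)
      show "norm (pairing_kernel n f g x u) =
          (ennreal (x ^ (2 * n - 1)) * ennreal (cmod (f x))) *
            (ennreal (u ^ (2 * n - 1)) * ennreal (cmod (g u))
              / ennreal (u ^ (2 * n) + x ^ (2 * n)))"
        using x u pos
        by (simp add: pairing_kernel_def norm_mult norm_divide norm_power divide_ennreal
            ennreal_mult'[symmetric] ac_simps del: of_real_add of_real_power ennreal_plus)
    qed
    then show "(\<integral>\<^sup>+u. norm (pairing_kernel n f g x u) \<partial>?M)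
        = ennreal (x ^ (2 * n - 1)) * ennreal (cmod (f x))
          * nn_potential2n n (\<lambda>u. ennreal (cmod (g u))) x"
      unfolding nn_potential2n_def by (simp add: nn_integral_cmult)
  qed
  also have "\<dots> < \<infinity>" using conv by (simp add: potential_pairing_abs_conv_def)
  finally show "(\<integral>\<^sup>+z. norm (case z of (x, u) \<Rightarrow> pairing_kernel n f g x u) \<partial>(?M \<Otimes>\<^sub>M ?M)) < \<infinity>" .
qed

text \<open>The product of \<open>y ^ (2 * n - 1)\<close> and the two Laplace integrands, with the
  exponentials merged. The variables \<open>x\<close> and \<open>u\<close> form one argument so that
  Fubini can exchange the pair with \<open>y\<close>.\<close>

definition laplace_kernel ::
    "nat \<Rightarrow> (real \<Rightarrow> complex) \<Rightarrow> (real \<Rightarrow> complex) \<Rightarrow> real \<times> real \<Rightarrow> real \<Rightarrow> complex" where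
  "laplace_kernel n f g = (\<lambda>(x, u) y.
     of_real (y ^ (2 * n - 1) * exp (- ((x ^ (2 * n) + u ^ (2 * n)) * y ^ (2 * n))))
     * (of_real (x ^ (2 * n - 1) * u ^ (2 * n - 1)) * (f x * g u)))"

lemma laplace_product_eq:
  "of_real (y ^ (2 * n - 1)) * laplace2n n f y * laplace2n n g y
    = (\<integral>x. \<integral>u. laplace_kernel n f g (x, u) y \<partial>lebesgue_on {0<..} \<partial>lebesgue_on {0<..})"
proof -
  \<comment> \<open>Only constants are moved through integrals here. If \<open>h\<close> or
    \<open>k\<close> is not integrable, both sides are 0.\<close>
  have product_eq: "a * integral\<^sup>L M h * integral\<^sup>L M k = (\<integral>x. \<integral>u. a * h x * k u \<partial>M \<partial>M)"
    for a :: complex and h k and M :: "real measure"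
    by simp
  show ?thesis
    unfolding laplace2n_def product_eq laplace_kernel_def
    by (intro Bochner_Integration.integral_cong refl)
      (simp add: exp_add[symmetric] algebra_simps flip: exp_of_real)
qed

lemma integral_laplace_kernel:
  assumes "n \<ge> 1" "x > 0" "u > 0"
  shows "(\<integral>y. laplace_kernel n f g (x, u) y \<partial>lebesgue_on {0<..})
    = 1 / (2 * of_nat n) * pairing_kernel n f g x u"
proof -
  have pos: "x ^ (2 * n) + u ^ (2 * n) > 0" using assms by (simp add: add_pos_pos)
  have "(\<integral>y. laplace_kernel n f g (x, u) y \<partial>lebesgue_on {0<..})
      = of_real (1 / (real (2 * n) * (x ^ (2 * n) + u ^ (2 * n))))
        * (of_real (x ^ (2 * n - 1) * u ^ (2 * n - 1)) * (f x * g u))"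
    unfolding laplace_kernel_def prod.case integral_mult_left_zero integral_complex_of_real
    using assms integral_power_exp[of "2 * n", OF _ pos] by simp
  then show ?thesis
    by (simp add: pairing_kernel_def)
qed

text \<open>Integrating out \<open>y\<close> loses nothing on passing to norms, because the factor
  depending on \<open>y\<close> is nonnegative. This supplies the bound for Tonelli.\<close>

lemma nn_integral_laplace_kernel:
  assumes "n \<ge> 1" "x > 0" "u > 0"
  shows "(\<integral>\<^sup>+y. norm (laplace_kernel n f g (x, u) y) \<partial>lebesgue_on {0<..})
    = ennreal (1 / (2 * n)) * norm (pairing_kernel n f g x u)"
proof -
  \<comment> \<open>All of the norm that does not depend on \<open>y\<close>.\<close>
  define c where "c = cmod (of_real (x ^ (2 * n - 1) * u ^ (2 * n - 1)) * (f x * g u))"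
  have pos: "x ^ (2 * n) + u ^ (2 * n) > 0" using assms by (simp add: add_pos_pos)
  have "(\<integral>\<^sup>+y. norm (laplace_kernel n f g (x, u) y) \<partial>lebesgue_on {0<..})
      = (\<integral>\<^sup>+y. ennreal (y ^ (2 * n - 1) * exp (- ((x ^ (2 * n) + u ^ (2 * n)) * y ^ (2 * n))))
          * ennreal c \<partial>lebesgue_on {0<..})"
    unfolding laplace_kernel_def prod.case norm_mult[of "of_real (_ * exp _)"] c_def[symmetric] norm_of_real
    by (intro nn_integral_cong)
      (simp add: space_restrict_space c_def ennreal_mult'[symmetric] abs_mult)
  also have "\<dots> = ennreal (1 / (real (2 * n) * (x ^ (2 * n) + u ^ (2 * n)))) * ennreal c"
    using assms nn_integral_power_exp[of "2 * n", OF _ pos] by (subst nn_integral_multc) auto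
  also have "\<dots> = ennreal (1 / (2 * n)) * norm (pairing_kernel n f g x u)"
    using pos assms
    by (simp add: pairing_kernel_def c_def norm_mult norm_divide norm_power ennreal_mult'[symmetric]
        del: of_real_add of_real_power)
  finally show ?thesis by simp
qed

text \<open>Tonelli with \<open>y\<close> integrated first reduces the threefold integral of the
  norm to \<open>1 / (2 * n)\<close> times that of the pairing kernel, already known to be
  finite.\<close>

lemma integrable_laplace_kernel:
  assumes "n \<ge> 1"
    and [measurable]: "f \<in> borel_measurable (lebesgue_on {0<..})"
      "g \<in> borel_measurable (lebesgue_on {0<..})"
    and conv: "potential_pairing_abs_conv n f g"
  shows "integrable ((lebesgue_on {0<..} \<Otimes>\<^sub>M lebesgue_on {0<..}) \<Otimes>\<^sub>M lebesgue_on {0<..})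
    (\<lambda>(z, y). laplace_kernel n f g z y)"
proof (rule integrableI_bounded)
  let ?M = "lebesgue_on {0<..} :: real measure"
  let ?K = "\<lambda>z. case z of (x, u) \<Rightarrow> pairing_kernel n f g x u"
  show [measurable]: "(\<lambda>(z, y). laplace_kernel n f g z y)
      \<in> borel_measurable ((?M \<Otimes>\<^sub>M ?M) \<Otimes>\<^sub>M ?M)"
    unfolding laplace_kernel_def case_prod_beta by measurable
  note int = integrable_pairing_kernel[OF assms(2-4)]
  then have [measurable]: "?K \<in> borel_measurable (?M \<Otimes>\<^sub>M ?M)" by (rule borel_measurable_integrable)
  have "(\<integral>\<^sup>+w. norm (case w of (z, y) \<Rightarrow> laplace_kernel n f g z y) \<partial>((?M \<Otimes>\<^sub>M ?M) \<Otimes>\<^sub>M ?M))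
      = (\<integral>\<^sup>+z. \<integral>\<^sup>+y. norm (laplace_kernel n f g z y) \<partial>?M \<partial>(?M \<Otimes>\<^sub>M ?M))"
    by (subst halfline.M1.nn_integral_fst[symmetric]) auto
  also have "\<dots> = (\<integral>\<^sup>+z. ennreal (1 / (2 * n)) * norm (?K z) \<partial>(?M \<Otimes>\<^sub>M ?M))"
    using nn_integral_laplace_kernel[OF \<open>n \<ge> 1\<close>]
    by (intro nn_integral_cong) (auto simp: space_pair_measure space_restrict_space)
  also have "\<dots> = ennreal (1 / (2 * n)) * (\<integral>\<^sup>+z. norm (?K z) \<partial>(?M \<Otimes>\<^sub>M ?M))"
    by (rule nn_integral_cmult) measurable
  also have "\<dots> < \<infinity>"
    using int by (simp add: integrable_iff_bounded ennreal_mult_less_top)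
  finally show "(\<integral>\<^sup>+w. norm (case w of (z, y) \<Rightarrow> laplace_kernel n f g z y)
      \<partial>((?M \<Otimes>\<^sub>M ?M) \<Otimes>\<^sub>M ?M)) < \<infinity>" .
qed

lemma laplace_product_eq_potential_pairing:
  assumes "n \<ge> 1"
    and [measurable]: "f \<in> borel_measurable (lebesgue_on {0<..})"
      "g \<in> borel_measurable (lebesgue_on {0<..})"
    and conv: "potential_pairing_abs_conv n f g"
  shows "(\<integral>y. of_real (y ^ (2 * n - 1)) * laplace2n n f y * laplace2n n g y \<partial>lebesgue_on {0<..})
    = 1 / (2 * of_nat n) *
      (\<integral>x. of_real (x ^ (2 * n - 1)) * f x * potential2n n g x \<partial>lebesgue_on {0<..})"
proof -
  let ?M = "lebesgue_on {0<..} :: real measure"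
  let ?L = "laplace_kernel n f g"
  interpret triple: pair_sigma_finite "?M \<Otimes>\<^sub>M ?M" ?M ..
  note int = integrable_laplace_kernel[OF assms]
  have [measurable]: "(\<lambda>(z, y). ?L z y) \<in> borel_measurable ((?M \<Otimes>\<^sub>M ?M) \<Otimes>\<^sub>M ?M)"
    using int by (rule borel_measurable_integrable)
  have "(\<integral>y. of_real (y ^ (2 * n - 1)) * laplace2n n f y * laplace2n n g y \<partial>?M)
      = (\<integral>y. \<integral>x. \<integral>u. ?L (x, u) y \<partial>?M \<partial>?M \<partial>?M)"
    by (simp only: laplace_product_eq)
  also have "\<dots> = (\<integral>y. \<integral>z. ?L z y \<partial>(?M \<Otimes>\<^sub>M ?M) \<partial>?M)"
  proof (rule integral_cong_AE)
    \<comment> \<open>Joining the integrals over \<open>x\<close> and \<open>u\<close> requires the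
      section at \<open>y\<close> to be integrable, which Fubini guarantees only for almost every
      \<open>y\<close>.\<close>
    show "AE y in ?M. (\<integral>x. \<integral>u. ?L (x, u) y \<partial>?M \<partial>?M) = (\<integral>z. ?L z y \<partial>(?M \<Otimes>\<^sub>M ?M))"
      using triple.AE_integrable_snd[OF int]
      by eventually_elim (rule halfline.integral_fst')
  qed measurable
  also have "\<dots> = (\<integral>z. \<integral>y. ?L z y \<partial>?M \<partial>(?M \<Otimes>\<^sub>M ?M))"
    by (rule triple.Fubini_integral[OF int])
  also have "\<dots> = (\<integral>z. 1 / (2 * of_nat n) * (case z of (x, u) \<Rightarrow> pairing_kernel n f g x u) \<partial>(?M \<Otimes>\<^sub>M ?M))"
    using integral_laplace_kernel[OF \<open>n \<ge> 1\<close>]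
    by (intro Bochner_Integration.integral_cong)
      (auto simp: space_pair_measure space_restrict_space)
  also have "\<dots> = 1 / (2 * of_nat n) * (\<integral>x. \<integral>u. pairing_kernel n f g x u \<partial>?M \<partial>?M)"
    unfolding integral_mult_right_zero
    by (simp only: halfline.integral_fst[OF integrable_pairing_kernel[OF assms(2-4)]])
  finally show ?thesis unfolding integral_pairing_kernel .
qed

text \<open>By the symmetry of the kernel, the two sides are the two iterated integrals of one
  integrable function on the product.\<close>

lemma potential_pairing_commute:
  assumes "f \<in> borel_measurable (lebesgue_on {0<..})"
    and "g \<in> borel_measurable (lebesgue_on {0<..})"
    and "potential_pairing_abs_conv n f g"
  shows "(\<integral>x. of_real (x ^ (2 * n - 1)) * f x * potential2n n g x \<partial>lebesgue_on {0<..})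
    = (\<integral>u. of_real (u ^ (2 * n - 1)) * g u * potential2n n f u \<partial>lebesgue_on {0<..})"
  unfolding integral_pairing_kernel pairing_kernel_commute[of n g f]
  by (rule halfline.Fubini_integral[symmetric, OF integrable_pairing_kernel[OF assms]])

theorem theorem1:
  fixes n :: nat and f g :: "real \<Rightarrow> complex"
  assumes "n \<ge> 1"
    and "f \<in> borel_measurable (lebesgue_on {0<..})"
    and "g \<in> borel_measurable (lebesgue_on {0<..})"
  shows
    "(laplace_product_abs_conv n f g \<and> potential_pairing_abs_conv n f g \<longrightarrow>
        (\<integral>y. of_real (y ^ (2 * n - 1)) * laplace2n n f y * laplace2n n g y \<partial>lebesgue_on {0<..})
        = 1 / (2 * of_nat n) *
          (\<integral>x. of_real (x ^ (2 * n - 1)) * f x * potential2n n g x \<partial>lebesgue_on {0<..}))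
     \<and> (laplace_product_abs_conv n f g \<and> potential_pairing_abs_conv n g f \<longrightarrow>
        (\<integral>y. of_real (y ^ (2 * n - 1)) * laplace2n n f y * laplace2n n g y \<partial>lebesgue_on {0<..})
        = 1 / (2 * of_nat n) *
          (\<integral>u. of_real (u ^ (2 * n - 1)) * g u * potential2n n f u \<partial>lebesgue_on {0<..}))
     \<and> (potential_pairing_abs_conv n f g \<and> potential_pairing_abs_conv n g f \<longrightarrow>
        (\<integral>x. of_real (x ^ (2 * n - 1)) * f x * potential2n n g x \<partial>lebesgue_on {0<..})
        = (\<integral>u. of_real (u ^ (2 * n - 1)) * g u * potential2n n f u \<partial>lebesgue_on {0<..}))"
  \<comment> \<open>The second identity is the first with \<open>f\<close> and \<open>g\<close>
    exchanged; commutativity restores the order of the Laplace factors.\<close>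
  using laplace_product_eq_potential_pairing[OF assms]
    laplace_product_eq_potential_pairing[OF assms(1,3,2)]
    potential_pairing_commute[OF assms(2,3)]
  by (simp add: mult.commute mult.left_commute)

end
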